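(* Let $\bar\omega<1/\sqrt2$ and $\bar v<1$ be constants, and let $\mathcal{D}_\omega=\{\boldsymbol{\omega}\in\mathbb{R}^3:|\boldsymbol{\omega}|\le\bar\omega\}$, $\mathcal{D}_v=\{\boldsymbol{v}\in\mathbb{R}^3:|\boldsymbol{v}|\le\bar v\}$. Let $(h,\boldsymbol{\omega},\boldsymbol{v})$ be a trajectory of the quadrotor dynamics on $SE(3)$ described in the context, with input $\boldsymbol{\mu}$, and assume that there exists $c>0$ such that $|J\boldsymbol{\mu}|\le c$. Put $g_k=hS^k$ and $f_k=(\omega^\times)^k\boldsymbol{v}$ for $k=0,1,2,\dots$, let $\underline{g}_k=\mathrm{vec}(g_k)$, and let a dot denote the time derivative along the trajectory. Then the sequences $\underline{g}_k,\dot{\underline{g}}_k,f_k,\dot f_k$ converge pointwise to zero as $k\to\infty$. That is, at every time $t$ at which $\boldsymbol{\omega}(t)\in\mathcal{D}_\omega$ and $\boldsymbol{v}(t)\in\mathcal{D}_v$ (with $h(t)\in SE(3)$ arbitrary), $$\lim_{k\to\infty}\underline{g}_k(t)=\mathbf{0},\quad \lim_{k\to\infty}\dot{\underline{g}}_k(t)=\mathbf{0},\quad \lim_{k\to\infty}f_k(t)=\mathbf{0},\quad \lim_{k\to\infty}\dot f_k(t)=\mathbf{0}.$$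
   Context: $|\cdot|$ is the Euclidean norm. For $\boldsymbol{a}\in\mathbb{R}^3$, $a^\times\in\mathbb{R}^{3\times3}$ is the skew-symmetric matrix with $a^\times\boldsymbol{b}=\boldsymbol{a}\times\boldsymbol{b}$ for all $\boldsymbol{b}\in\mathbb{R}^3$. For a matrix $A$, $\mathrm{vec}(A)$ is the vector obtained by stacking its columns. $SE(3)$ is the set of $4\times4$ matrices $h=\begin{bmatrix}R&\boldsymbol{p}\\ \mathbf{0}&1\end{bmatrix}$ with $R\in SO(3)$ and $\boldsymbol{p}\in\mathbb{R}^3$. Quadrotor dynamics: the state is $h\in SE(3)$ (attitude $R$ and position $\boldsymbol{p}$), the angular velocity $\boldsymbol{\omega}\in\mathbb{R}^3$ and the linear velocity $\boldsymbol{v}\in\mathbb{R}^3$, both in the body-fixed frame. With $$S=\begin{bmatrix}\omega^\times&\boldsymbol{v}\\ \mathbf{0}&0\end{bmatrix}\in\mathbb{R}^{4\times4},$$ a trajectory is a triple of differentiable functions of time satisfying $$\dot h=hS,\qquad J\dot{\boldsymbol{\omega}}=\boldsymbol{\mu},\qquad \dot{\boldsymbol{v}}=\tfrac1m F\boldsymbol{e}_3-\omega^\times\boldsymbol{v}-g R^{\mathrm T}\boldsymbol{e}_3 .$$ Here $J\in\mathbb{R}^{3\times3}$ is the positive definite inertia matrix, $m>0$ the mass, $g$ the (scalar) gravitational acceleration, $\boldsymbol{e}_3=[0,0,1]^{\mathrm T}$, $F(t)\in\mathbb{R}$ the total thrust, and $\boldsymbol{\mu}(t)\in\mathbb{R}^3$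 the modified control input (the whole right-hand side of the rotational equation). $F$ and $\boldsymbol{\mu}$ are given functions of time. *)

theory Defs
  imports "HOL-Analysis.Analysis"
begin

definition hat :: "real^3 \<Rightarrow> real^3^3" where
  "hat a = matrix (\<lambda>b. cross3 a b)"

lemma hat_mult_vec: "hat a *v b = cross3 a b"
proof -
  have "linear (\<lambda>b. cross3 a b)"
    by (rule linearI) (simp_all add: cross_add_right cross_mult_right)
  then show ?thesis
    by (simp add: hat_def matrix_works)
qed

lemma hat_skew: "transpose (hat a) = - hat a"
  by (simp add: hat_def matrix_def cross3_def transpose_def vec_eq_iff forall_3 vector_3 axis_def)

(* The library's power operator on vectors and matrices acts entrywise, so the power
   with respect to the matrix product is defined separately. *)
primrec mat_power :: "real^'n^'n \<Rightarrow> nat \<Rightarrow> real^'n^'n" where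
  "mat_power A 0 = mat 1"
| "mat_power A (Suc k) = A ** mat_power A k"

(* Stacked columns: the pair (j, i) is the position of the i-th entry of the j-th column;
   in lexicographic order these positions run through column 1, then column 2, and so on. *)
definition vec_cols :: "real^'n^'m \<Rightarrow> real^('n \<times> 'm)" where
  "vec_cols A = (\<chi> q. A $ snd q $ fst q)"

(* The block matrix [[A, b], [0, c]]. *)
definition block4 :: "real^3^3 \<Rightarrow> real^3 \<Rightarrow> real \<Rightarrow> real^4^4" where
  "block4 A b c = vector
     [vector [A$1$1, A$1$2, A$1$3, b$1],
      vector [A$2$1, A$2$2, A$2$3, b$2],
      vector [A$3$1, A$3$2, A$3$3, b$3],
      vector [0, 0, 0, c]]"

lemma vector_4:
  "(vector [w, x, y, z] :: 'a::zero^4) $ 1 = w"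
  "(vector [w, x, y, z] :: 'a::zero^4) $ 2 = x"
  "(vector [w, x, y, z] :: 'a::zero^4) $ 3 = y"
  "(vector [w, x, y, z] :: 'a::zero^4) $ 4 = z"
  by (simp_all add: vector_def)

lemma block4_inject: "block4 A b c = block4 A' b' c' \<longleftrightarrow> A = A' \<and> b = b' \<and> c = c'"
  by (auto simp: block4_def vec_eq_iff forall_3 forall_4 vector_4)

definition SE3 :: "(real^4^4) set" where
  "SE3 = {block4 R p 1 | R p. rotation_matrix R}"

(* The upper left 3x3 block. *)
definition attitude :: "real^4^4 \<Rightarrow> real^3^3" where
  "attitude h = vector
     [vector [h$1$1, h$1$2, h$1$3],
      vector [h$2$1, h$2$2, h$2$3],
      vector [h$3$1, h$3$2, h$3$3]]"

lemma attitude_block4: "attitude (block4 R p c) = R"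
  by (simp add: attitude_def block4_def vec_eq_iff forall_3 vector_3 vector_4)

definition twist :: "real^3 \<Rightarrow> real^3 \<Rightarrow> real^4^4" where
  "twist w v = block4 (hat w) v 0"

definition e3 :: "real^3" where
  "e3 = axis 3 1"

(* Symmetry is not required, so symmetric positive definite matrices are a special case. *)
definition pos_definite :: "real^'n^'n \<Rightarrow> bool" where
  "pos_definite A \<longleftrightarrow> (\<forall>x. x \<noteq> 0 \<longrightarrow> 0 < x \<bullet> (A *v x))"

(* T is the time domain.  At end points of T the derivatives are one-sided. *)
definition quadrotor_trajectory ::
  "real set \<Rightarrow> real^3^3 \<Rightarrow> real \<Rightarrow> real \<Rightarrow> (real \<Rightarrow> real) \<Rightarrow> (real \<Rightarrow> real^3) \<Rightarrow>
   (real \<Rightarrow> real^4^4) \<Rightarrow> (real \<Rightarrow> real^3) \<Rightarrow> (real \<Rightarrow> real^3) \<Rightarrow> bool" where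
  "quadrotor_trajectory T J m g F \<mu> h \<omega> v \<longleftrightarrow>
     (\<forall>t\<in>T.
        h t \<in> SE3 \<and>
        (h has_vector_derivative h t ** twist (\<omega> t) (v t)) (at t within T) \<and>
        (\<exists>\<omega>'. (\<omega> has_vector_derivative \<omega>') (at t within T) \<and> J *v \<omega>' = \<mu> t) \<and>
        (v has_vector_derivative
           ((1 / m) * F t) *\<^sub>R e3 - hat (\<omega> t) *v v t
             - g *\<^sub>R (transpose (attitude (h t)) *v e3)) (at t within T))"

definition g_seq ::
  "(real \<Rightarrow> real^4^4) \<Rightarrow> (real \<Rightarrow> real^3) \<Rightarrow> (real \<Rightarrow> real^3) \<Rightarrow> nat \<Rightarrow> real \<Rightarrow> real^4^4" where
  "g_seq h \<omega> v k t = h t ** mat_power (twist (\<omega> t) (v t)) k"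

definition f_seq :: "(real \<Rightarrow> real^3) \<Rightarrow> (real \<Rightarrow> real^3) \<Rightarrow> nat \<Rightarrow> real \<Rightarrow> real^3" where
  "f_seq \<omega> v k t = mat_power (hat (\<omega> t)) k *v v t"

end

theory Submission
  imports Defs
begin

section \<open>Recursions with geometric decay\<close>

text \<open>The forcing decays at the same rate \<open>q\<close> as the homogeneous recursion, and
  this resonance costs a factor linear in \<open>k\<close>. Its slope is \<open>c / q\<close>
  because each step adds \<open>c * q ^ k = (c / q) * q ^ Suc k\<close>.\<close>

lemma geometric_perturbed_bound:
  fixes d :: "nat \<Rightarrow> real"
  assumes q: "0 < q" and step: "\<And>k. d (Suc k) \<le> q * d k + c * q ^ k"
  shows "d k \<le> (d 0 + real k * (c / q)) * q ^ k"
proof (induction k)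
  case (Suc k)
  have "d (Suc k) \<le> q * ((d 0 + real k * (c / q)) * q ^ k) + c * q ^ k"
    using step[of k] mult_left_mono[OF Suc.IH, of q] q by linarith
  also have "\<dots> = (d 0 + real (Suc k) * (c / q)) * q ^ Suc k"
    using q by (simp add: field_simps)
  finally show ?case .
qed simp

lemma geometric_perturbed_tendsto_0:
  fixes x :: "nat \<Rightarrow> 'a::real_normed_vector"
  assumes q: "0 < q" "q < 1"
    and step: "\<And>k. norm (x (Suc k)) \<le> q * norm (x k) + c * q ^ k"
  shows "x \<longlonglongrightarrow> 0"
proof (rule Lim_null_comparison)
  show "\<forall>\<^sub>F k in sequentially. norm (x k) \<le> norm (x 0) * q ^ k + (c / q) * (real k * q ^ k)"
    using geometric_perturbed_bound[of q "\<lambda>k. norm (x k)" c] q step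
    by (simp add: algebra_simps)
  have "(\<lambda>k. real k * q ^ k) \<longlonglongrightarrow> 0" "(\<lambda>k. q ^ k) \<longlonglongrightarrow> 0"
    using powser_times_n_limit_0[of q] LIMSEQ_power_zero[of q] q by auto
  then show "(\<lambda>k. norm (x 0) * q ^ k + (c / q) * (real k * q ^ k)) \<longlonglongrightarrow> 0"
    by (intro tendsto_add_zero tendsto_mult_right_zero)
qed

text \<open>
  The contraction is only required on a set \<open>V\<close> that absorbs all iterates after the first one:
  for the twist matrix it fails on vectors with nonzero last component.
\<close>
lemma bilinear_iterates_tendsto_0:
  fixes X :: "nat \<Rightarrow> real \<Rightarrow> 'a::real_normed_vector"
    and L :: "real \<Rightarrow> 'b::real_normed_vector"
  assumes B: "bounded_bilinear B"
    and X: "\<And>k s. X (Suc k) s = B (L s) (X k s)"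
    and X0: "(X 0 has_vector_derivative X0') (at t within T)"
    and L: "(L has_vector_derivative L') (at t within T)"
    and q: "0 < q" "q < 1"
    and contr: "\<And>y. y \<in> V \<Longrightarrow> norm (B (L t) y) \<le> q * norm y"
    and V: "\<And>y. B (L t) y \<in> V" "\<And>y z. B (L t) y + B L' z \<in> V"
  shows "(\<lambda>k. X k t) \<longlonglongrightarrow> 0"
    and "\<exists>D. (\<forall>k. (X k has_vector_derivative D k) (at t within T)) \<and> D \<longlonglongrightarrow> 0"
proof -
  interpret bounded_bilinear B by (rule B)
  \<comment> \<open>The product rule for \<open>B (L s) (X k s)\<close>, read as a recursion:
    \<open>D\<close> is again an iteration of \<open>B (L t)\<close>, now forced by
    \<open>B L' (X k t)\<close>.\<close>
  define D where "D = rec_nat X0' (\<lambda>k d. B (L t) d + B L' (X k t))"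
  have D_Suc: "D (Suc k) = B (L t) (D k) + B L' (X k t)" for k
    by (simp add: D_def)
  have deriv: "(X k has_vector_derivative D k) (at t within T)" for k
  proof (induction k)
    case 0
    then show ?case using X0 by (simp add: D_def)
  next
    case (Suc k)
    have "X (Suc k) = (\<lambda>s. B (L s) (X k s))" by (simp add: X fun_eq_iff)
    then show ?case using has_vector_derivative[OF L Suc.IH] by (simp add: D_Suc)
  qed
  \<comment> \<open>\<open>X 0 t\<close> may lie outside \<open>V\<close>, so the contraction is
    available from index 1 on, and the estimates below concern sequences shifted by one.\<close>
  have X_V: "X (Suc k) t \<in> V" for k by (simp add: X V)
  have X_contr: "norm (X (Suc (Suc k)) t) \<le> q * norm (X (Suc k) t)" for k
    using contr[OF X_V[of k]] by (simp add: X[of "Suc k"])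
  show "(\<lambda>k. X k t) \<longlonglongrightarrow> 0"
    by (rule LIMSEQ_imp_Suc, rule geometric_perturbed_tendsto_0[OF q, where c = 0])
      (simp add: X_contr)
  \<comment> \<open>Convergence alone would not do here: the explicit rate is what makes the forcing
    term of \<open>D\<close> decay like \<open>q ^ k\<close>.\<close>
  have X_bound: "norm (X (Suc k) t) \<le> norm (X 1 t) * q ^ k" for k
    using geometric_perturbed_bound[of q "\<lambda>k. norm (X (Suc k) t)" 0 k] q X_contr by simp
  obtain K where K: "K \<ge> 0" "\<And>a b. norm (B a b) \<le> norm a * norm b * K"
    using nonneg_bounded by blast
  define c where "c = norm L' * norm (X 1 t) * K"
  have "norm (D (Suc (Suc k))) \<le> q * norm (D (Suc k)) + c * q ^ k" for k
  proof -
    have "norm (B (L t) (D (Suc k))) \<le> q * norm (D (Suc k))"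
      \<comment> \<open>\<open>D (Suc k)\<close> has the form \<open>B (L t) y + B L' z\<close>, so
        the second closure property in \<open>V\<close> applies.\<close>
      by (rule contr) (simp add: D_Suc V)
    moreover have "norm (B L' (X (Suc k) t)) \<le> c * q ^ k"
    proof -
      have "norm (B L' (X (Suc k) t)) \<le> norm L' * norm (X (Suc k) t) * K"
        by (rule K)
      also have "\<dots> \<le> norm L' * (norm (X 1 t) * q ^ k) * K"
        by (intro mult_right_mono mult_left_mono X_bound K norm_ge_zero)
      finally show ?thesis by (simp add: c_def mult_ac)
    qed
    moreover have "norm (D (Suc (Suc k))) \<le> norm (B (L t) (D (Suc k))) + norm (B L' (X (Suc k) t))"
      unfolding D_Suc[of "Suc k"] by (rule norm_triangle_ineq)
    ultimately show ?thesis by linarith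
  qed
  then have "D \<longlonglongrightarrow> 0"
    by (intro LIMSEQ_imp_Suc[of D] geometric_perturbed_tendsto_0[OF q, where c = c])
  with deriv show "\<exists>D. (\<forall>k. (X k has_vector_derivative D k) (at t within T)) \<and> D \<longlonglongrightarrow> 0"
    by blast
qed

section \<open>Norm estimates for the cross product and the twist matrix\<close>

lemma norm_cross3_le: "norm (cross3 a b) \<le> norm a * norm b"
proof (rule power2_le_imp_le)
  show "(norm (cross3 a b))\<^sup>2 \<le> (norm a * norm b)\<^sup>2"
    \<comment> \<open>Lagrange's identity: the two squares differ by
      \<open>(a \<bullet> b)\<^sup>2\<close>.\<close>
    unfolding norm_cross_dot[of a b, symmetric] by simp
qed simp

lemma bounded_bilinear_cross3: "bounded_bilinear cross3"
  by (metis bilinear_cross bilinear_conv_bounded_bilinear)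

lemma bounded_bilinear_matrix_mult:
  "bounded_bilinear ((**) :: real^'n^'m \<Rightarrow> real^'p^'n \<Rightarrow> real^'p^'m)"
  unfolding bilinear_conv_bounded_bilinear[symmetric] bilinear_def linear_iff
  by (auto simp: matrix_matrix_mult_def vec_eq_iff sum_distrib_left algebra_simps sum.distrib)

text \<open>The norm on matrices is the Frobenius norm, built up from the rows; it is regrouped by
  columns because left multiplication acts column by column.\<close>

lemma norm_matrix_columns:
  fixes A :: "real^'n^'m"
  shows "norm A = L2_set (\<lambda>j. norm (column j A)) UNIV"
proof -
  have "(\<Sum>i\<in>UNIV. \<Sum>j\<in>UNIV. (A $ i $ j)\<^sup>2) = (\<Sum>j\<in>UNIV. \<Sum>i\<in>UNIV. (A $ i $ j)\<^sup>2)"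
    by (rule sum.swap)
  then show ?thesis
    by (simp add: norm_vec_def L2_set_def column_def sum_nonneg)
qed

text \<open>Bounding \<open>A\<close> only on the columns of \<open>M\<close>, instead of by an
  operator norm, matters because \<open>norm_twist_le\<close> is confined to vectors with last
  component 0.\<close>

lemma norm_matrix_mult_le:
  fixes A :: "real^'n^'m" and M :: "real^'p^'n"
  assumes "0 \<le> q" "\<And>j. norm (A *v column j M) \<le> q * norm (column j M)"
  shows "norm (A ** M) \<le> q * norm M"
proof -
  have "column j (A ** M) = A *v column j M" for j
    by (simp add: vec_eq_iff column_def matrix_matrix_mult_def matrix_vector_mult_def)
  then show ?thesis
    unfolding norm_matrix_columns L2_set_right_distrib[OF assms(1)]
    by (intro L2_set_mono) (auto simp: assms)
qed

text \<open>This makes the matrices with zero last row an absorbing set for left multiplication by a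
  twist.\<close>

lemma twist_mult_last_row: "(twist w v ** M) $ 4 $ j = 0"
  by (simp add: twist_def block4_def matrix_matrix_mult_def vector_4 sum_4)

lemma norm_vec3_vec4:
  fixes y :: "real^4"
  assumes "y $ 4 = 0"
  shows "norm (vector [y$1, y$2, y$3] :: real^3) = norm y"
  by (simp add: norm_vec_def L2_set_def sum_3 sum_4 vector_3 assms)

text \<open>The column \<open>v\<close> gets multiplied by \<open>y $ 4 = 0\<close>, so what remains
  is the cross product with \<open>w\<close> on the first three components.\<close>

lemma norm_twist_le:
  fixes y :: "real^4"
  assumes "y $ 4 = 0"
  shows "norm (twist w v *v y) \<le> norm w * norm y"
proof -
  let ?y = "vector [y$1, y$2, y$3] :: real^3" and ?z = "twist w v *v y"
  have z4: "?z $ 4 = 0"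
    by (simp add: twist_def block4_def matrix_vector_mult_def vector_4 sum_4)
  have "vector [?z$1, ?z$2, ?z$3] = hat w *v ?y"
    by (simp add: twist_def block4_def matrix_vector_mult_def vector_4 vector_3 sum_4 sum_3
        vec_eq_iff forall_3 assms)
  then show ?thesis
    using norm_cross3_le[of w ?y] norm_vec3_vec4[OF assms] norm_vec3_vec4[OF z4]
    by (simp add: hat_mult_vec)
qed

lemma bounded_linear_twist: "bounded_linear (\<lambda>(w, v). twist w v)"
  by (subst linear_conv_bounded_linear[symmetric], rule linearI)
    (auto simp: twist_def block4_def hat_def matrix_def cross3_def vec_eq_iff forall_4 vector_4
      algebra_simps)

lemma bounded_linear_vec_cols: "bounded_linear (vec_cols :: real^'n^'m \<Rightarrow> _)"
  by (subst linear_conv_bounded_linear[symmetric], rule linearI)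
    (auto simp: vec_cols_def vec_eq_iff)

section \<open>Convergence of the sequences and their derivatives\<close>

lemma f_seq_tendsto_0:
  assumes \<omega>: "(\<omega> has_vector_derivative \<omega>') (at t within T)"
    and v: "(v has_vector_derivative v') (at t within T)"
    and q: "norm (\<omega> t) \<le> q" "0 < q" "q < 1"
  shows "(\<lambda>k. f_seq \<omega> v k t) \<longlonglongrightarrow> 0"
    and "\<exists>D. (\<forall>k. (f_seq \<omega> v k has_vector_derivative D k) (at t within T)) \<and> D \<longlonglongrightarrow> 0"
proof -
  have f_Suc: "f_seq \<omega> v (Suc k) s = cross3 (\<omega> s) (f_seq \<omega> v k s)" for k s
    by (simp add: f_seq_def matrix_vector_mul_assoc[symmetric] hat_mult_vec)
  have "f_seq \<omega> v 0 = v"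
    by (simp add: f_seq_def fun_eq_iff)
  then have f_0: "(f_seq \<omega> v 0 has_vector_derivative v') (at t within T)"
    using v by simp
  have "norm (cross3 (\<omega> t) y) \<le> q * norm y" for y
    by (rule order_trans[OF norm_cross3_le mult_right_mono[OF q(1) norm_ge_zero]])
  \<comment> \<open>The cross product with \<open>\<omega> t\<close> contracts every vector, so the
    whole space serves as absorbing set.\<close>
  note * = bilinear_iterates_tendsto_0[OF bounded_bilinear_cross3 f_Suc f_0 \<omega> q(2,3),
      where V = UNIV, OF this UNIV_I UNIV_I]
  show "(\<lambda>k. f_seq \<omega> v k t) \<longlonglongrightarrow> 0"
    and "\<exists>D. (\<forall>k. (f_seq \<omega> v k has_vector_derivative D k) (at t within T)) \<and> D \<longlonglongrightarrow> 0"
    by (fact *)+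
qed

lemma twist_power_tendsto_0:
  assumes \<omega>: "(\<omega> has_vector_derivative \<omega>') (at t within T)"
    and v: "(v has_vector_derivative v') (at t within T)"
    and q: "norm (\<omega> t) \<le> q" "0 < q" "q < 1"
  defines "P \<equiv> \<lambda>k s. mat_power (twist (\<omega> s) (v s)) k"
  shows "(\<lambda>k. P k t) \<longlonglongrightarrow> 0"
    and "\<exists>D. (\<forall>k. (P k has_vector_derivative D k) (at t within T)) \<and> D \<longlonglongrightarrow> 0"
proof -
  let ?S = "\<lambda>s. twist (\<omega> s) (v s)"
  have P_Suc: "P (Suc k) s = ?S s ** P k s" for k s
    by (simp add: P_def)
  have P_0: "(P 0 has_vector_derivative 0) (at t within T)"
    by (simp add: P_def)
  have S: "(?S has_vector_derivative twist \<omega>' v') (at t within T)"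
    using bounded_linear.has_vector_derivative[OF bounded_linear_twist
        has_vector_derivative_Pair[OF \<omega> v]] by simp
  \<comment> \<open>All columns of such a matrix satisfy the hypothesis of
    \<open>norm_twist_le\<close>. The initial power \<open>mat 1\<close> is not in this set; every
    later power is, having a twist as left factor.\<close>
  let ?V = "{M :: real^4^4. \<forall>j. M $ 4 $ j = 0}"
  have contr: "norm (?S t ** M) \<le> q * norm M" if "M \<in> ?V" for M
  proof (rule norm_matrix_mult_le)
    fix j
    have "norm (?S t *v column j M) \<le> norm (\<omega> t) * norm (column j M)"
      using that by (intro norm_twist_le) (simp add: column_def)
    also have "\<dots> \<le> q * norm (column j M)"
      by (intro mult_right_mono q norm_ge_zero)
    finally show "norm (?S t *v column j M) \<le> q * norm (column j M)" .
  qed (use q in simp)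
  note * = bilinear_iterates_tendsto_0[OF bounded_bilinear_matrix_mult P_Suc P_0 S q(2,3),
      where V = ?V, OF contr]
  show "(\<lambda>k. P k t) \<longlonglongrightarrow> 0"
    and "\<exists>D. (\<forall>k. (P k has_vector_derivative D k) (at t within T)) \<and> D \<longlonglongrightarrow> 0"
    by (rule *; simp add: twist_mult_last_row)+
qed

text \<open>At the fixed time \<open>t\<close> both \<open>h t\<close> and \<open>h'\<close> are
  constant left factors, so the product rule reduces everything to the twist powers and their
  derivatives; the linear map \<open>vec_cols\<close> preserves limits and derivatives.\<close>

lemma vec_cols_g_seq_tendsto_0:
  assumes h: "(h has_vector_derivative h') (at t within T)"
    and \<omega>: "(\<omega> has_vector_derivative \<omega>') (at t within T)"
    and v: "(v has_vector_derivative v') (at t within T)"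
    and q: "norm (\<omega> t) \<le> q" "0 < q" "q < 1"
  shows "(\<lambda>k. vec_cols (g_seq h \<omega> v k t)) \<longlonglongrightarrow> 0"
    and "\<exists>D. (\<forall>k. ((\<lambda>s. vec_cols (g_seq h \<omega> v k s)) has_vector_derivative D k) (at t within T))
          \<and> D \<longlonglongrightarrow> 0"
proof -
  interpret mult: bounded_bilinear "(**) :: real^4^4 \<Rightarrow> real^4^4 \<Rightarrow> real^4^4"
    by (rule bounded_bilinear_matrix_mult)
  interpret vec: bounded_linear "vec_cols :: real^4^4 \<Rightarrow> _"
    by (rule bounded_linear_vec_cols)
  let ?P = "\<lambda>k s. mat_power (twist (\<omega> s) (v s)) k"
  have P: "(\<lambda>k. ?P k t) \<longlonglongrightarrow> 0" by (rule twist_power_tendsto_0[OF \<omega> v q])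
  obtain D where D: "\<And>k. (?P k has_vector_derivative D k) (at t within T)" "D \<longlonglongrightarrow> 0"
    using twist_power_tendsto_0(2)[OF \<omega> v q] by blast
  have mult_P: "(\<lambda>k. A ** ?P k t) \<longlonglongrightarrow> 0" for A :: "real^4^4"
    using mult.tendsto[OF tendsto_const[of A] P] by (simp add: mult.zero_right)
  show "(\<lambda>k. vec_cols (g_seq h \<omega> v k t)) \<longlonglongrightarrow> 0"
    using vec.tendsto[OF mult_P[of "h t"]] by (simp add: g_seq_def vec.zero)
  have "(\<lambda>k. h t ** D k) \<longlonglongrightarrow> 0"
    using mult.tendsto[OF tendsto_const[of "h t"] D(2)] by (simp add: mult.zero_right)
  then have "(\<lambda>k. vec_cols (h t ** D k + h' ** ?P k t)) \<longlonglongrightarrow> 0"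
    using vec.tendsto[OF tendsto_add_zero[OF _ mult_P[of h']]] by (simp add: vec.zero)
  moreover have "((\<lambda>s. vec_cols (g_seq h \<omega> v k s)) has_vector_derivative
      vec_cols (h t ** D k + h' ** ?P k t)) (at t within T)" for k
    unfolding g_seq_def by (intro vec.has_vector_derivative mult.has_vector_derivative h D)
  ultimately show "\<exists>D. (\<forall>k. ((\<lambda>s. vec_cols (g_seq h \<omega> v k s)) has_vector_derivative D k)
      (at t within T)) \<and> D \<longlonglongrightarrow> 0"
    by (intro exI[of _ "\<lambda>k. vec_cols (h t ** D k + h' ** ?P k t)"]) simp
qed

text \<open>A nontrivial filter makes derivatives unique, so \<open>vector_derivative\<close> must
  agree with the sequence \<open>D\<close> that is known to exist.\<close>

lemma vector_derivative_within_tendsto_0: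
  assumes "at t within T \<noteq> bot"
    and "\<exists>D. (\<forall>k. (X k has_vector_derivative D k) (at t within T)) \<and> D \<longlonglongrightarrow> 0"
  shows "(\<lambda>k::nat. vector_derivative (X k) (at t within T)) \<longlonglongrightarrow> 0"
proof -
  obtain D where D: "\<And>k. (X k has_vector_derivative D k) (at t within T)" "D \<longlonglongrightarrow> 0"
    using assms(2) by blast
  have "vector_derivative (X k) (at t within T) = D k" for k
    by (rule vector_derivative_within[OF assms(1) D(1)])
  with D(2) show ?thesis by simp
qed

theorem theorem2:
  fixes T :: "real set" and J :: "real^3^3" and m g :: real
    and F :: "real \<Rightarrow> real" and \<mu> :: "real \<Rightarrow> real^3"
    and h :: "real \<Rightarrow> real^4^4" and \<omega> v :: "real \<Rightarrow> real^3"
    and \<omega>bar vbar :: real and D\<omega> Dv :: "(real^3) set"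
  assumes "is_interval T" and "interior T \<noteq> {}"
    and "pos_definite J" and "m > 0"
    and "\<omega>bar < 1 / sqrt 2" and "vbar < 1"
    and "D\<omega> = {w. norm w \<le> \<omega>bar}" and "Dv = {u. norm u \<le> vbar}"
    and "quadrotor_trajectory T J m g F \<mu> h \<omega> v"
    and "\<exists>c>0. \<forall>t\<in>T. norm (J *v \<mu> t) \<le> c"
  shows "\<forall>t\<in>T. \<omega> t \<in> D\<omega> \<and> v t \<in> Dv \<longrightarrow>
    (\<lambda>k. vec_cols (g_seq h \<omega> v k t)) \<longlonglongrightarrow> 0 \<and>
    (\<lambda>k. vector_derivative (\<lambda>s. vec_cols (g_seq h \<omega> v k s)) (at t within T)) \<longlonglongrightarrow> 0 \<and>
    (\<lambda>k. f_seq \<omega> v k t) \<longlonglongrightarrow> 0 \<and>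
    (\<lambda>k. vector_derivative (f_seq \<omega> v k) (at t within T)) \<longlonglongrightarrow> 0"
proof (intro ballI impI)
  fix t assume t: "t \<in> T" and in_D: "\<omega> t \<in> D\<omega> \<and> v t \<in> Dv"
  \<comment> \<open>A connected set that is not a singleton has no isolated points, so the filter is
    nontrivial at every \<open>t\<close> in \<open>T\<close>, end points included.\<close>
  have "\<nexists>a. T = {a}" using assms(2) by auto
  then have nontriv: "at t within T \<noteq> bot"
    using connected_imp_perfect[of T t] is_interval_connected[OF assms(1)] t
    by (auto simp: trivial_limit_within)
  obtain h' \<omega>' v' where derivs:
    "(h has_vector_derivative h') (at t within T)"
    "(\<omega> has_vector_derivative \<omega>') (at t within T)"
    "(v has_vector_derivative v') (at t within T)"
    using assms(9) t unfolding quadrotor_trajectory_def by blast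
  \<comment> \<open>The decay rate has to be positive, while \<open>\<omega>bar\<close> could be 0;
    hence \<open>1 / sqrt 2\<close> is taken as the rate.\<close>
  have q: "norm (\<omega> t) \<le> 1 / sqrt 2" "0 < 1 / sqrt 2" "1 / sqrt 2 < 1"
    using in_D assms(5,7) by auto
  note g = vec_cols_g_seq_tendsto_0[OF derivs q] and f = f_seq_tendsto_0[OF derivs(2,3) q]
  show "(\<lambda>k. vec_cols (g_seq h \<omega> v k t)) \<longlonglongrightarrow> 0 \<and>
    (\<lambda>k. vector_derivative (\<lambda>s. vec_cols (g_seq h \<omega> v k s)) (at t within T)) \<longlonglongrightarrow> 0 \<and>
    (\<lambda>k. f_seq \<omega> v k t) \<longlonglongrightarrow> 0 \<and>
    (\<lambda>k. vector_derivative (f_seq \<omega> v k) (at t within T)) \<longlonglongrightarrow> 0"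
    using g(1) f(1) vector_derivative_within_tendsto_0[OF nontriv g(2)]
      vector_derivative_within_tendsto_0[OF nontriv f(2)] by blast
qed

end
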